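(* Let $f\in\mathbb{R}[x_1,\ldots,x_n]$ be a homogeneous polynomial of degree 3 and let $\mathcal{V}$ be the subspace of $M_n(\mathbb{R})$ spanned by the slices of $f$. The following are equivalent: (i) $f$ is equivalent as a real polynomial to a sum of $n$ cubes; (ii) there exist two invertible matrices $A,B\in\mathcal{V}$ such that $A^{-1}\mathcal{V}$ is a commuting subspace and $B$ is positive definite; (iii) $\mathcal{V}$ contains a positive definite matrix, and $A^{-1}\mathcal{V}$ is a commuting subspace for every invertible $A\in\mathcal{V}$.
   Context: $f$ is equivalent as a real polynomial to a sum of $n$ cubes if $f(x)=P_3(Ax)$ for some nonsingular $A\in M_n(\mathbb{R})$, where $P_3=x_1^3+\cdots+x_n^3$. The slices of $f$: let $T_{ijk}=\frac16\,\partial^3 f/\partial x_i\partial x_j\partial x_k$; the $i$-th slice is the symmetric matrix $T_i$ with $(T_i)_{jk}=T_{ijk}$. $A^{-1}\mathcal{V}=\{A^{-1}M:M\in\mathcal{V}\}$; a subspace of matrices is commuting if any two of its elements commute. *)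

theory Defs
  imports "HOL-Analysis.Analysis" "HOL-Library.Poly_Mapping"
begin

text \<open>Polynomials in the variables \<open>x\<^sub>i\<close>, \<open>i :: 'n\<close>, are finitely supported maps from exponent vectors
  to coefficients, with the convolution product of \<^theory>\<open>HOL-Library.Poly_Mapping\<close>.
  The number of variables is \<open>n = CARD('n)\<close>.\<close>

type_synonym 'n rpoly = "('n \<Rightarrow>\<^sub>0 nat) \<Rightarrow>\<^sub>0 real"

definition pvar :: "'n \<Rightarrow> 'n rpoly" where
  "pvar i = Poly_Mapping.single (Poly_Mapping.single i 1) 1"

definition pconst :: "real \<Rightarrow> 'n rpoly" where
  "pconst c = Poly_Mapping.single 0 c"

text \<open>The zero polynomial is homogeneous of every degree.\<close>

definition homogeneous :: "nat \<Rightarrow> 'n::finite rpoly \<Rightarrow> bool" where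
  "homogeneous d f \<longleftrightarrow> (\<forall>m\<in>Poly_Mapping.keys f. (\<Sum>i\<in>UNIV. Poly_Mapping.lookup m i) = d)"

text \<open>If \<open>m\<close> does not contain \<open>x\<^sub>i\<close>, the truncated difference of exponents is harmless because the
  coefficient is 0.\<close>

definition pderivative :: "'n \<Rightarrow> 'n rpoly \<Rightarrow> 'n rpoly" where
  "pderivative i f = (\<Sum>m\<in>Poly_Mapping.keys f.
     Poly_Mapping.single (m - Poly_Mapping.single i 1)
       (real (Poly_Mapping.lookup m i) * Poly_Mapping.lookup f m))"

text \<open>\<open>linear_subst f A\<close> is the polynomial \<open>f(Ax)\<close>: the variable \<open>x\<^sub>i\<close> is replaced by the linear form
  \<open>\<Sum>j. A $ i $ j * x\<^sub>j\<close>.\<close>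

definition linear_subst :: "'n::finite rpoly \<Rightarrow> real^'n^'n \<Rightarrow> 'n rpoly" where
  "linear_subst f A = (\<Sum>m\<in>Poly_Mapping.keys f. pconst (Poly_Mapping.lookup f m) *
     (\<Prod>i\<in>UNIV. (\<Sum>j\<in>UNIV. pconst (A $ i $ j) * pvar j) ^ Poly_Mapping.lookup m i))"

definition sum_of_cubes :: "'n::finite rpoly" where
  "sum_of_cubes = (\<Sum>i\<in>UNIV. pvar i ^ 3)"

definition equivalent_to_sum_of_cubes :: "'n::finite rpoly \<Rightarrow> bool" where
  "equivalent_to_sum_of_cubes f \<longleftrightarrow>
     (\<exists>A :: real^'n^'n. invertible A \<and> f = linear_subst sum_of_cubes A)"

text \<open>For \<open>f\<close> homogeneous of degree 3 the third derivatives are constant polynomials; the coefficient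
  at the exponent vector 0 is that constant.\<close>

definition slice :: "'n::finite rpoly \<Rightarrow> 'n \<Rightarrow> real^'n^'n" where
  "slice f i = (\<chi> j k. 1/6 *
     Poly_Mapping.lookup (pderivative i (pderivative j (pderivative k f))) 0)"

definition slice_space :: "'n::finite rpoly \<Rightarrow> (real^'n^'n) set" where
  "slice_space f = span (range (slice f))"

definition commuting :: "(real^'n::finite^'n) set \<Rightarrow> bool" where
  "commuting W \<longleftrightarrow> (\<forall>M\<in>W. \<forall>N\<in>W. M ** N = N ** M)"

definition positive_definite :: "real^'n::finite^'n \<Rightarrow> bool" where
  "positive_definite B \<longleftrightarrow> transpose B = B \<and> (\<forall>x. x \<noteq> 0 \<longrightarrow> x \<bullet> (B *v x) > 0)"

end

theory Submission
  imports Defs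
begin

text \<open>If \<open>f(x) = P\<^sub>3(Ax)\<close>, the \<open>i\<close>-th slice is \<open>A\<^sup>TD\<^sub>iA\<close> with \<open>D\<^sub>i\<close> diagonal, and
  \<open>A\<^sup>TA\<close> is a combination of these; this gives (iii), which implies (ii) since positive definite
  matrices are invertible. Assume (ii). Then \<open>B\<^sup>-\<^sup>1\<V>\<close> is also commuting, and its elements are
  self-adjoint for the inner product \<open>x \<bullet> (B y)\<close>. A basis of common eigenvectors, orthonormal for
  this product, yields an invertible \<open>Q\<close> such that every slice is \<open>T\<^sub>i = Q\<^sup>TD\<^sub>iQ\<close> with \<open>D\<^sub>i\<close>
  diagonal. The full symmetry of \<open>T\<^sub>i\<^sub>j\<^sub>k\<close> forces \<open>(D\<^sub>i)\<^sub>l\<^sub>l = s\<^sub>l Q\<^sub>l\<^sub>i\<close>, where \<open>s\<^sub>l \<noteq> 0\<close>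
  because \<open>\<V>\<close> contains an invertible matrix. Absorbing the real cube roots of the \<open>s\<^sub>l\<close> into
  \<open>Q\<close> gives (i).\<close>

section \<open>Derivatives and slices\<close>

text \<open>The coefficientwise form of the derivative: with it, additivity and the symmetry of
  mixed derivatives become identities between coefficients.\<close>

lemma lookup_pderivative:
  "Poly_Mapping.lookup (pderivative i f) m
    = real (Poly_Mapping.lookup m i + 1) * Poly_Mapping.lookup f (m + Poly_Mapping.single i 1)"
proof -
  let ?m' = "m + Poly_Mapping.single i 1"
  \<comment> \<open>Truncated subtraction also fixes every exponent vector that lacks
    \<open>i\<close>. Such a vector contributes coefficient 0, and on the others the shift can be
    undone.\<close>
  have shift: "m'' = ?m'" if "m'' - Poly_Mapping.single i 1 = m" "Poly_Mapping.lookup m'' i \<noteq> 0" for m''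
    using that by (auto intro!: poly_mapping_eqI simp: lookup_add lookup_minus lookup_single when_def)
  have "Poly_Mapping.lookup (pderivative i f) m
      = (\<Sum>m''\<in>Poly_Mapping.keys f. (if m'' = ?m'
          then real (Poly_Mapping.lookup ?m' i) * Poly_Mapping.lookup f ?m' else 0))"
    unfolding pderivative_def lookup_sum lookup_single
    by (rule sum.cong) (use shift in \<open>fastforce simp: when_def\<close>)+
  also have "\<dots> = real (Poly_Mapping.lookup ?m' i) * Poly_Mapping.lookup f ?m'"
    by (simp add: in_keys_iff)
  finally show ?thesis
    by (simp add: lookup_add)
qed

lemma pderivative_add: "pderivative i (f + g) = pderivative i f + pderivative i g"
  by (rule poly_mapping_eqI) (simp add: lookup_pderivative lookup_add algebra_simps)

lemma pderivative_0 [simp]: "pderivative i 0 = 0"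
  by (rule poly_mapping_eqI) (simp add: lookup_pderivative)

lemma pderivative_sum: "pderivative i (\<Sum>a\<in>S. f a) = (\<Sum>a\<in>S. pderivative i (f a))"
  by (induction S rule: infinite_finite_induct) (auto simp: pderivative_add)

lemma pderivative_commute: "pderivative i (pderivative j f) = pderivative j (pderivative i f)"
proof (rule poly_mapping_eqI)
  show "Poly_Mapping.lookup (pderivative i (pderivative j f)) m
      = Poly_Mapping.lookup (pderivative j (pderivative i f)) m" for m
    by (cases "i = j") (auto simp: lookup_pderivative lookup_add lookup_single ac_simps)
qed

lemma pderivative_single:
  "pderivative i (Poly_Mapping.single m c)
    = Poly_Mapping.single (m - Poly_Mapping.single i 1) (real (Poly_Mapping.lookup m i) * c)"
  by (cases "c = 0") (simp_all add: pderivative_def)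

text \<open>Both sides are bilinear, so the product rule only has to be checked on monomials and
  then summed over the terms of \<open>f\<close> and \<open>g\<close>.\<close>

lemma pderivative_mult: "pderivative i (f * g) = pderivative i f * g + f * pderivative i g"
proof -
  let ?e = "Poly_Mapping.single i (Suc 0)"
  have mono: "pderivative i (Poly_Mapping.single a c * Poly_Mapping.single b d)
     = pderivative i (Poly_Mapping.single a c) * Poly_Mapping.single b d
       + Poly_Mapping.single a c * pderivative i (Poly_Mapping.single b d)" for a b and c d :: real
  proof -
    \<comment> \<open>Moving the subtraction onto one factor is valid only if that factor contains
      the variable. Otherwise the coefficient in \<open>A\<close> and \<open>B\<close> is 0 and both
      monomials vanish.\<close>
    have split: "x + y - ?e = (x - ?e) + y" if "Poly_Mapping.lookup x i \<noteq> 0" for x y :: "'a \<Rightarrow>\<^sub>0 nat"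
      using that by (auto intro!: poly_mapping_eqI simp: lookup_add lookup_minus lookup_single when_def)
    have A: "Poly_Mapping.single (a + b - ?e) (real (Poly_Mapping.lookup a i) * r)
        = Poly_Mapping.single ((a - ?e) + b) (real (Poly_Mapping.lookup a i) * r)" for r
      by (cases "Poly_Mapping.lookup a i = 0") (simp_all add: split)
    have B: "Poly_Mapping.single (a + b - ?e) (real (Poly_Mapping.lookup b i) * r)
        = Poly_Mapping.single (a + (b - ?e)) (real (Poly_Mapping.lookup b i) * r)" for r
      by (cases "Poly_Mapping.lookup b i = 0") (simp_all add: split add.commute[of a])
    show ?thesis
      using A[of "c * d"] B[of "c * d"]
      by (simp add: mult_single pderivative_single lookup_add distrib_right distrib_left single_add mult.assoc
          mult.left_commute)
  qed
  have expand: "h = (\<Sum>m\<in>Poly_Mapping.keys h. Poly_Mapping.single m (Poly_Mapping.lookup h m))"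
    for h :: "'a rpoly"
    by (rule poly_mapping_eqI) (simp add: lookup_sum lookup_single when_def in_keys_iff)
  have "pderivative i ((\<Sum>a\<in>S. Poly_Mapping.single a (c a)) * (\<Sum>b\<in>R. Poly_Mapping.single b (d b)))
     = pderivative i (\<Sum>a\<in>S. Poly_Mapping.single a (c a)) * (\<Sum>b\<in>R. Poly_Mapping.single b (d b))
       + (\<Sum>a\<in>S. Poly_Mapping.single a (c a)) * pderivative i (\<Sum>b\<in>R. Poly_Mapping.single b (d b))"
    for S R and c d :: "_ \<Rightarrow> real"
    by (simp add: sum_product pderivative_sum mono sum.distrib)
  from this[of "Poly_Mapping.lookup f" "Poly_Mapping.keys f" "Poly_Mapping.lookup g" "Poly_Mapping.keys g"]
  show ?thesis
    by (simp only: expand[symmetric])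
qed

section \<open>Slices determine a cubic form\<close>

lemma slice_nth:
  "slice f i $ j $ k
    = 1/6 * Poly_Mapping.lookup (pderivative i (pderivative j (pderivative k f))) 0"
  by (simp add: slice_def)

lemma slice_commute: "slice f i $ j $ k = slice f j $ i $ k"
  by (simp add: slice_nth pderivative_commute[of i j])

lemma transpose_slice: "transpose (slice f i) = slice f i"
  by (simp add: vec_eq_iff transpose_def slice_nth pderivative_commute)

text \<open>Every monomial of degree 3 is a product of three variables, and its coefficient is, up
  to a nonzero factor that does not depend on the polynomial, an entry of a slice. Homogeneity
  excludes all other monomials.\<close>

lemma homogeneous_eqI:
  fixes f g :: "'n::finite rpoly"
  assumes f: "homogeneous 3 f" and g: "homogeneous 3 g"
    and eq: "\<And>i. slice f i = slice g i"
  shows "f = g"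
proof (rule poly_mapping_eqI)
  fix m :: "'n \<Rightarrow>\<^sub>0 nat"
  let ?e = "\<lambda>i. Poly_Mapping.single i (1::nat)"
  show "Poly_Mapping.lookup f m = Poly_Mapping.lookup g m"
  proof (cases "(\<Sum>i\<in>UNIV. Poly_Mapping.lookup m i) = 3")
    case True
    \<comment> \<open>A monomial of positive degree contains some variable; removing it once lowers
      the degree by one. Three rounds bring the degree down to 0.\<close>
    have peel: "\<exists>i m'. m = m' + ?e i \<and> (\<Sum>i\<in>UNIV. Poly_Mapping.lookup m' i) = d"
      if deg: "(\<Sum>i\<in>UNIV. Poly_Mapping.lookup m i) = Suc d" for m :: "'n \<Rightarrow>\<^sub>0 nat" and d
    proof -
      obtain i where i: "Poly_Mapping.lookup m i \<noteq> 0"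
        using deg by (metis sum.neutral Zero_not_Suc)
      have m: "m = (m - ?e i) + ?e i"
        using i by (auto intro!: poly_mapping_eqI simp: lookup_add lookup_minus lookup_single when_def)
      have "(\<Sum>j\<in>UNIV. Poly_Mapping.lookup m j)
          = (\<Sum>j\<in>UNIV. Poly_Mapping.lookup (m - ?e i) j) + (\<Sum>j\<in>UNIV. Poly_Mapping.lookup (?e i) j)"
        by (simp only: m[symmetric] lookup_add[symmetric] sum.distrib[symmetric])
      moreover have "(\<Sum>j\<in>UNIV. Poly_Mapping.lookup (?e i) j) = 1"
        by (simp add: lookup_single when_def)
      ultimately show ?thesis
        using deg m by (metis Suc_eq_plus1 add_right_cancel)
    qed
    have "(\<Sum>i\<in>UNIV. Poly_Mapping.lookup m i) = Suc (Suc (Suc 0))"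
      using True by simp
    then obtain i m1 where 1: "m = m1 + ?e i" "(\<Sum>i\<in>UNIV. Poly_Mapping.lookup m1 i) = Suc (Suc 0)"
      using peel by blast
    obtain j m2 where 2: "m1 = m2 + ?e j" "(\<Sum>i\<in>UNIV. Poly_Mapping.lookup m2 i) = Suc 0"
      using peel[OF 1(2)] by blast
    obtain k m3 where 3: "m2 = m3 + ?e k" "(\<Sum>i\<in>UNIV. Poly_Mapping.lookup m3 i) = 0"
      using peel[OF 2(2)] by blast
    have "m3 = 0"
      using 3(2) by (intro poly_mapping_eqI) simp
    have m: "m = 0 + ?e k + ?e j + ?e i"
      unfolding 1(1) 2(1) 3(1) \<open>m3 = 0\<close> ..
    \<comment> \<open>The normalisation 1/6 times the exponents brought down by the three
      differentiations. It depends on \<open>m\<close> only, so the same \<open>c\<close> serves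
      \<open>f\<close> and \<open>g\<close>.\<close>
    define c :: real where "c = 1/6 * (real (Poly_Mapping.lookup 0 k + 1)
      * (real (Poly_Mapping.lookup (0 + ?e k) j + 1)
      * real (Poly_Mapping.lookup (0 + ?e k + ?e j) i + 1)))"
    have coeff: "slice h k $ j $ i = c * Poly_Mapping.lookup h m" for h
      unfolding slice_nth lookup_pderivative m c_def by (simp only: mult.assoc)
    have "c \<noteq> 0"
      unfolding c_def by (simp only: mult_eq_0_iff of_nat_eq_0_iff) simp
    moreover have "c * Poly_Mapping.lookup f m = c * Poly_Mapping.lookup g m"
      unfolding coeff[symmetric] eq ..
    ultimately show ?thesis
      by simp
  next
    case False
    then have "m \<notin> Poly_Mapping.keys f" "m \<notin> Poly_Mapping.keys g"
      using f g by (auto simp: homogeneous_def)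
    then show ?thesis
      by (simp add: in_keys_iff)
  qed
qed

section \<open>Sums of cubes of linear forms and their slices\<close>

lemma pderivative_pconst [simp]: "pderivative i (pconst c) = 0"
  by (simp add: pconst_def pderivative_single)

lemma pderivative_pvar: "pderivative i (pvar j) = (if i = j then 1 else 0)"
  by (auto simp: pvar_def pderivative_single lookup_single when_def)

lemma pconst_mult: "pconst c * pconst d = pconst (c * d)"
  by (simp add: pconst_def mult_single)

lemma lookup_pconst_0: "Poly_Mapping.lookup (pconst c) 0 = c"
  by (simp add: pconst_def)

lemma pconst_1 [simp]: "pconst 1 = 1"
  by (simp add: pconst_def)

lemma pderivative_numeral [simp]: "pderivative i (numeral n) = 0"
proof -
  have "pderivative i (of_nat k) = 0" for k
    using pderivative_pconst[of i 1] by (induction k) (auto simp: pderivative_add)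
  then show ?thesis
    by (metis of_nat_numeral)
qed

lemma linear_subst_sum_of_cubes:
  fixes A :: "real^'n::finite^'n"
  shows "linear_subst sum_of_cubes A
    = (\<Sum>l\<in>UNIV. (\<Sum>j\<in>UNIV. pconst (A $ l $ j) * pvar j) ^ 3)"
proof -
  let ?X = "\<lambda>l. Poly_Mapping.single l (3::nat)"
  have cube: "pvar l ^ 3 = Poly_Mapping.single (?X l) 1" for l :: 'n
  proof -
    have "Poly_Mapping.single l (Suc 0) + (Poly_Mapping.single l (Suc 0) + Poly_Mapping.single l (Suc 0)) = ?X l"
      by (rule poly_mapping_eqI) (simp add: lookup_add lookup_single when_def)
    then show ?thesis
      by (simp add: power3_eq_cube pvar_def mult_single add.assoc)
  qed
  \<comment> \<open>Distinct variables give distinct exponent vectors, so the cubes do not merge: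
    each key of \<open>sum_of_cubes\<close> has coefficient 1, and the sum over keys in
    \<open>linear_subst\<close> becomes a sum over variables.\<close>
  have inj: "inj ?X"
    by (rule injI) (metis lookup_single_eq lookup_single_not_eq zero_neq_numeral)
  have look: "Poly_Mapping.lookup (sum_of_cubes :: 'n rpoly) m = (if m \<in> range ?X then 1 else 0)" for m
  proof -
    have "Poly_Mapping.lookup (sum_of_cubes :: 'n rpoly) m = (\<Sum>l\<in>UNIV. if ?X l = m then 1 else 0)"
      by (simp add: sum_of_cubes_def cube lookup_sum lookup_single when_def)
    also have "\<dots> = (\<Sum>x\<in>range ?X. if x = m then 1 else 0)"
      by (simp add: sum.reindex[OF inj])
    finally show ?thesis by simp
  qed
  have keys: "Poly_Mapping.keys (sum_of_cubes :: 'n rpoly) = range ?X"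
    by (rule set_eqI) (simp add: in_keys_iff look)
  have "linear_subst sum_of_cubes A = (\<Sum>l\<in>UNIV.
     (\<Prod>i\<in>UNIV. (\<Sum>j\<in>UNIV. pconst (A $ i $ j) * pvar j) ^ Poly_Mapping.lookup (?X l) i))"
    by (simp add: linear_subst_def keys look sum.reindex[OF inj])
  moreover have "(\<Prod>i\<in>UNIV. L i ^ Poly_Mapping.lookup (?X l) i) = L l ^ 3" for L :: "'n \<Rightarrow> 'n rpoly" and l
  proof -
    have "(\<Prod>i\<in>UNIV. L i ^ Poly_Mapping.lookup (?X l) i) = (\<Prod>i\<in>UNIV. if i = l then L i ^ 3 else 1)"
      by (rule prod.cong) (auto simp: lookup_single when_def)
    then show ?thesis by simp
  qed
  ultimately show ?thesis by simp
qed

lemma homogeneous_0: "homogeneous d 0"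
  by (simp add: homogeneous_def)

lemma homogeneous_add: "homogeneous d f \<Longrightarrow> homogeneous d g \<Longrightarrow> homogeneous d (f + g)"
  using Poly_Mapping.keys_add[of f g] by (auto simp: homogeneous_def)

lemma homogeneous_sum: "(\<And>a. a \<in> S \<Longrightarrow> homogeneous d (f a)) \<Longrightarrow> homogeneous d (\<Sum>a\<in>S. f a)"
  by (induction S rule: infinite_finite_induct) (auto simp: homogeneous_0 homogeneous_add)

lemma homogeneous_mult:
  assumes "homogeneous d f" "homogeneous e g"
  shows "homogeneous (d + e) (f * g)"
  unfolding homogeneous_def
proof
  fix m assume "m \<in> Poly_Mapping.keys (f * g)"
  then obtain a b where "a \<in> Poly_Mapping.keys f" "b \<in> Poly_Mapping.keys g" "m = a + b"
    using keys_mult[of f g] by blast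
  then show "(\<Sum>i\<in>UNIV. Poly_Mapping.lookup m i) = d + e"
    using assms by (auto simp: homogeneous_def lookup_add sum.distrib)
qed

lemma homogeneous_linear_form: "homogeneous 1 (\<Sum>j\<in>UNIV. pconst (c j) * pvar j)"
  by (rule homogeneous_sum)
    (auto simp: homogeneous_def pconst_def pvar_def mult_single lookup_single when_def)

text \<open>Needed to compare \<open>f\<close> with a sum of cubes through
  \<open>homogeneous_eqI\<close>.\<close>

lemma homogeneous_linear_subst_sum_of_cubes:
  fixes A :: "real^'n::finite^'n"
  shows "homogeneous 3 (linear_subst sum_of_cubes A)"
proof -
  have cube: "homogeneous 3 (L ^ 3)" if "homogeneous 1 L" for L :: "'n rpoly"
    using homogeneous_mult[OF that homogeneous_mult[OF that that]]
    by (simp add: power3_eq_cube mult.assoc numeral_3_eq_3)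
  show ?thesis
    unfolding linear_subst_sum_of_cubes by (intro homogeneous_sum cube homogeneous_linear_form)
qed

text \<open>A linear form has constant derivatives, so the third derivative of its cube is 6 times a
  product of three of its coefficients, and the 1/6 in \<open>slice\<close> cancels the 6.\<close>

lemma slice_linear_subst_sum_of_cubes:
  "slice (linear_subst sum_of_cubes A) i $ j $ k = (\<Sum>l\<in>UNIV. A $ l $ i * A $ l $ j * A $ l $ k)"
proof -
  define L where "L = (\<lambda>l. \<Sum>j\<in>UNIV. pconst (A $ l $ j) * pvar j)"
  have dL: "pderivative i (L l) = pconst (A $ l $ i)" for i l
  proof -
    have "pderivative i (L l) = (\<Sum>j\<in>UNIV. if i = j then pconst (A $ l $ i) else 0)"
      unfolding L_def pderivative_sum
      by (rule sum.cong) (auto simp: pderivative_mult pderivative_pvar)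
    then show ?thesis by simp
  qed
  \<comment> \<open>Coefficient extraction is additive, so writing the factor 6 as a repeated sum
    avoids evaluating a convolution.\<close>
  have six: "6 * p = p + p + p + p + p + p" for p :: "'a rpoly"
    by (simp add: algebra_simps)
  have d3: "pderivative i (pderivative j (pderivative k (L l ^ 3)))
      = 6 * pconst (A $ l $ i * A $ l $ j * A $ l $ k)" for l
    by (simp add: power3_eq_cube pderivative_mult pderivative_add dL pconst_mult algebra_simps)
  have "1/6 * Poly_Mapping.lookup (pderivative i (pderivative j (pderivative k (L l ^ 3)))) 0
      = A $ l $ i * A $ l $ j * A $ l $ k" for l
    unfolding d3 six lookup_add lookup_pconst_0 by simp
  then show ?thesis
    unfolding slice_nth linear_subst_sum_of_cubes pderivative_sum lookup_sum sum_distrib_left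
    by (simp add: L_def)
qed

section \<open>Simultaneous diagonalization\<close>

text \<open>The variational proof of the spectral theorem for the inner product given by
  \<open>B\<close>: a maximiser of the Rayleigh quotient over the nonzero vectors of
  \<open>W\<close> is an eigenvector.\<close>

lemma selfadjoint_eigenvector:
  fixes B K :: "real^'n::finite^'n"
  assumes B: "positive_definite B"
    and adj: "\<And>x y. x \<bullet> (B *v (K *v y)) = (K *v x) \<bullet> (B *v y)"
    and W: "subspace W" and ne: "\<exists>x\<in>W. x \<noteq> 0"
    and inv: "\<And>x. x \<in> W \<Longrightarrow> K *v x \<in> W"
  shows "\<exists>x\<in>W. x \<noteq> 0 \<and> (\<exists>c. K *v x = c *\<^sub>R x)"
proof -
  define b where "b = (\<lambda>x y. x \<bullet> (B *v y))"
  define R where "R = (\<lambda>x. b x (K *v x) / b x x)"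
  have b_add: "b (x + y) z = b x z + b y z" "b z (x + y) = b z x + b z y"
    and b_scale: "b (t *\<^sub>R x) z = t * b x z" "b z (t *\<^sub>R x) = t * b z x" for x y z t
    by (simp_all add: b_def inner_add matrix_vector_right_distrib matrix_vector_mult_scaleR)
  have pos: "b x x > 0" if "x \<noteq> 0" for x
    using B that by (simp add: b_def positive_definite_def)
  have sym: "b x y = b y x" for x y
    using B by (metis b_def positive_definite_def dot_lmul_matrix inner_commute transpose_matrix_vector)
  have adj': "b x (K *v y) = b (K *v x) y" for x y
    by (simp add: b_def adj)
  \<comment> \<open>The Euclidean unit sphere provides compactness. The quotient \<open>R\<close> is
    invariant under scaling, so its maximum on \<open>S\<close> bounds it on all nonzero vectors of
    \<open>W\<close>.\<close>
  define S where "S = W \<inter> sphere 0 1"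
  have "compact S"
    unfolding S_def using W by (metis closed_subspace closed_Int_compact compact_sphere)
  moreover obtain u where u: "u \<in> W" "u \<noteq> 0"
    using ne by blast
  have "(1 / norm u) *\<^sub>R u \<in> S"
    using u W by (simp add: S_def subspace_scale)
  then have "S \<noteq> {}"
    by blast
  moreover have "x \<bullet> (B *v x) \<noteq> 0" if "x \<in> S" for x
    using pos[of x] that unfolding S_def b_def by fastforce
  then have "continuous_on S R"
    unfolding R_def b_def matrix_vector_mul_assoc
    by (intro continuous_intros) auto
  ultimately obtain x0 where x0: "x0 \<in> S" and max: "\<And>y. y \<in> S \<Longrightarrow> R y \<le> R x0"
    using continuous_attains_sup[of S R] by blast
  have x0': "x0 \<in> W" "x0 \<noteq> 0"
    using x0 by (auto simp: S_def)
  define c where "c = R x0"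
  \<comment> \<open>By maximality this quadratic form is nonnegative on \<open>W\<close> and
    vanishes at \<open>x0\<close>.\<close>
  define q where "q = (\<lambda>y. c * b y y - b y (K *v y))"
  have q_nonneg: "q y \<ge> 0" if y: "y \<in> W" for y
  proof (cases "y = 0")
    case False
    let ?y = "(1 / norm y) *\<^sub>R y"
    have "?y \<in> S"
      using y False W by (simp add: S_def subspace_scale)
    moreover have "R ?y = R y"
      using False by (simp add: R_def b_scale matrix_vector_mult_scaleR)
    ultimately have "R y \<le> c"
      using max c_def by metis
    then show ?thesis
      using pos[OF False] by (simp add: q_def R_def field_simps)
  qed (simp add: q_def b_def)
  have q_x0: "q x0 = 0"
    using pos[OF x0'(2)] by (simp add: q_def c_def R_def)
  \<comment> \<open>The residual of the eigenvalue equation. If it were nonzero, moving from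
    \<open>x0\<close> a little in its direction, which stays in \<open>W\<close>, would make
    \<open>q\<close> negative.\<close>
  define w where "w = K *v x0 - c *\<^sub>R x0"
  have wW: "w \<in> W"
    unfolding w_def using x0' W inv by (intro subspace_diff subspace_scale) auto
  have Kx0: "K *v x0 = w + c *\<^sub>R x0"
    by (simp add: w_def)
  have w_K: "b x0 (K *v w) = b w w + c * b x0 w" "b w (K *v x0) = b w w + c * b x0 w"
    unfolding adj' sym[of w "K *v x0"] Kx0 by (simp_all add: b_add b_scale sym[of w x0])
  have "b x0 (K *v x0) = c * b x0 x0"
    using q_x0 by (simp add: q_def)
  then have expand: "q (x0 + t *\<^sub>R w) = - 2 * t * b w w + t\<^sup>2 * q w" for t
    unfolding q_def matrix_vector_right_distrib matrix_vector_mult_scaleR b_add b_scale w_K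
      sym[of w x0]
    by (simp add: algebra_simps power2_eq_square)
  have "w = 0"
  proof (rule ccontr)
    assume "w \<noteq> 0"
    define \<beta> where "\<beta> = b w w"
    have \<beta>: "\<beta> > 0"
      using pos \<open>w \<noteq> 0\<close> by (simp add: \<beta>_def)
    \<comment> \<open>The summand 1 keeps the denominator positive even if \<open>q w = 0\<close>,
      and the choice gives \<open>t * q w = \<beta> - t\<close>, which is less than
      \<open>2 * \<beta>\<close>, so the linear term dominates.\<close>
    define t where "t = \<beta> / (q w + 1)"
    have g: "q w \<ge> 0"
      by (rule q_nonneg[OF wW])
    have t: "t > 0" "t * (q w + 1) = \<beta>"
      using \<beta> g by (auto simp: t_def)
    have "0 \<le> q (x0 + t *\<^sub>R w)"
      using x0' wW W by (intro q_nonneg subspace_add subspace_scale)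
    also have "\<dots> = t * (t * q w - 2 * \<beta>)"
      unfolding expand \<beta>_def by (simp add: algebra_simps power2_eq_square)
    finally have "2 * \<beta> \<le> t * q w"
      using t by (simp add: zero_le_mult_iff)
    moreover have "t * q w = \<beta> - t"
      using t by (simp add: algebra_simps)
    ultimately have "2 * \<beta> \<le> \<beta> - t"
      by (simp only:)
    then show False
      using t(1) \<beta> by linarith
  qed
  then have "K *v x0 = c *\<^sub>R x0"
    by (simp add: Kx0)
  with x0' show ?thesis by blast
qed

text \<open>Induction on the dimension of \<open>W\<close>, which also covers infinite
  \<open>F\<close>. If all of \<open>F\<close> acts on \<open>W\<close> by scalars, any nonzero
  vector works. Otherwise an eigenspace of some nonscalar \<open>K\<close> in \<open>W\<close> is a
  smaller nonzero subspace, invariant under \<open>F\<close> by commutativity.\<close>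

lemma common_eigenvector:
  fixes B :: "real^'n::finite^'n"
  assumes B: "positive_definite B"
    and adj: "\<And>K x y. K \<in> F \<Longrightarrow> x \<bullet> (B *v (K *v y)) = (K *v x) \<bullet> (B *v y)"
    and comm: "commuting F"
    and "subspace W" and "\<exists>x\<in>W. x \<noteq> 0"
    and "\<And>K x. K \<in> F \<Longrightarrow> x \<in> W \<Longrightarrow> K *v x \<in> W"
  shows "\<exists>x\<in>W. x \<noteq> 0 \<and> (\<forall>K\<in>F. \<exists>c. K *v x = c *\<^sub>R x)"
  using assms(4-)
proof (induction "dim W" arbitrary: W rule: less_induct)
  case less
  show ?case
  proof (cases "\<forall>K\<in>F. \<exists>c. \<forall>x\<in>W. K *v x = c *\<^sub>R x")
    case True
    then show ?thesis
      using less.prems(2) by blast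
  next
    case False
    then obtain K where K: "K \<in> F" and nonscalar: "\<And>c. \<exists>x\<in>W. K *v x \<noteq> c *\<^sub>R x"
      by blast
    obtain u c where u: "u \<in> W" "u \<noteq> 0" "K *v u = c *\<^sub>R u"
      using selfadjoint_eigenvector[OF B adj[OF K] less.prems(1,2) less.prems(3)[OF K]] by blast
    let ?W = "{x \<in> W. K *v x = c *\<^sub>R x}"
    have sub: "subspace ?W"
      using less.prems(1)
      by (auto simp: subspace_def matrix_vector_right_distrib matrix_vector_mult_scaleR
          scaleR_add_right)
    have "?W \<subset> W"
      using nonscalar[of c] by blast
    then have "dim ?W < dim W"
      using sub less.prems(1) by (metis dim_psubset span_eq_iff)
    moreover have "L *v x \<in> ?W" if L: "L \<in> F" and x: "x \<in> ?W" for L x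
    proof -
      have "K *v (L *v x) = L *v (K *v x)"
        using comm K L by (simp add: commuting_def matrix_vector_mul_assoc)
      also have "\<dots> = c *\<^sub>R (L *v x)"
        using x by (simp add: matrix_vector_mult_scaleR)
      finally show ?thesis
        using less.prems(3)[OF L] x by simp
    qed
    moreover have "\<exists>x\<in>?W. x \<noteq> 0"
      using u by blast
    ultimately have "\<exists>x\<in>?W. x \<noteq> 0 \<and> (\<forall>K\<in>F. \<exists>c. K *v x = c *\<^sub>R x)"
      using less.hyps[of ?W] sub by blast
    then show ?thesis by blast
  qed
qed

text \<open>The basis is built one vector at a time: the \<open>B\<close>-orthogonal complement of
  the eigenvectors found so far is invariant under \<open>F\<close> by self-adjointness, so it
  contains a further common eigenvector.\<close>

lemma orthonormal_common_eigenvectors: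
  fixes B :: "real^'n::finite^'n"
  assumes B: "positive_definite B"
    and adj: "\<And>K x y. K \<in> F \<Longrightarrow> x \<bullet> (B *v (K *v y)) = (K *v x) \<bullet> (B *v y)"
    and comm: "commuting F"
  shows "\<exists>e :: 'n \<Rightarrow> real^'n. (\<forall>i j. e i \<bullet> (B *v e j) = (if i = j then 1 else 0))
    \<and> (\<forall>K\<in>F. \<forall>i. \<exists>c. K *v e i = c *\<^sub>R e i)"
proof -
  have sym: "x \<bullet> (B *v y) = y \<bullet> (B *v x)" for x y
    using B by (metis positive_definite_def dot_lmul_matrix inner_commute transpose_matrix_vector)
  define good where "good = (\<lambda>E. finite E \<and>
    (\<forall>x\<in>E. \<forall>y\<in>E. x \<bullet> (B *v y) = (if x = y then 1 else 0)) \<and>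
    (\<forall>K\<in>F. \<forall>x\<in>E. \<exists>c. K *v x = c *\<^sub>R x))"
  have "\<exists>E. good E \<and> card E = k" if "k \<le> CARD('n)" for k
    using that
  proof (induction k)
    case 0
    show ?case
      by (intro exI[of _ "{}"]) (simp add: good_def)
  next
    case (Suc k)
    then obtain E where E: "good E" "card E = k"
      by auto
    then have "finite E"
      by (simp add: good_def)
    let ?W = "{x. \<forall>y\<in>E. y \<bullet> (B *v x) = 0}"
    \<comment> \<open>The complement is nonzero: the at most \<open>k\<close> images of
      \<open>E\<close> under \<open>B\<close> span a proper subspace, and Euclidean orthogonality to
      \<open>B *v y\<close> is \<open>B\<close>-orthogonality to \<open>y\<close>.\<close>
    have "dim ((*v) B ` E) \<le> k"
      using \<open>finite E\<close> E by (metis card_image_le dim_le_card' finite_imageI le_trans)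
    then have "dim ((*v) B ` E) < DIM(real^'n)"
      using Suc.prems by simp
    then obtain u where "u \<noteq> 0" and u: "\<And>y. y \<in> span ((*v) B ` E) \<Longrightarrow> orthogonal u y"
      by (metis orthogonal_to_subspace_exists)
    have "y \<bullet> (B *v u) = 0" if "y \<in> E" for y
      using u[of "B *v y"] that by (simp add: sym[of y u] orthogonal_def span_base)
    with \<open>u \<noteq> 0\<close> have "\<exists>u\<in>?W. u \<noteq> 0"
      by blast
    moreover have "subspace ?W"
      by (auto simp: subspace_def inner_add matrix_vector_right_distrib matrix_vector_mult_scaleR)
    moreover have "K *v x \<in> ?W" if K: "K \<in> F" and x: "x \<in> ?W" for K x
    proof -
      have "y \<bullet> (B *v (K *v x)) = 0" if y: "y \<in> E" for y
      proof -
        obtain c where "K *v y = c *\<^sub>R y"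
          using E K y unfolding good_def by blast
        then show ?thesis
          using x y by (simp add: adj[OF K])
      qed
      then show ?thesis by simp
    qed
    ultimately obtain x where x: "x \<in> ?W" "x \<noteq> 0" and eig: "\<And>K. K \<in> F \<Longrightarrow> \<exists>c. K *v x = c *\<^sub>R x"
      using common_eigenvector[OF B adj comm, of ?W] by blast
    have pos: "x \<bullet> (B *v x) > 0"
      using B x by (simp add: positive_definite_def)
    define z where "z = (1 / sqrt (x \<bullet> (B *v x))) *\<^sub>R x"
    have zW: "z \<in> ?W"
      using x by (simp add: z_def matrix_vector_mult_scaleR)
    have zz: "z \<bullet> (B *v z) = 1"
      using pos by (simp add: z_def matrix_vector_mult_scaleR field_simps)
    have "z \<notin> E"
      using zW zz by auto
    moreover have "\<exists>c. K *v z = c *\<^sub>R z" if K: "K \<in> F" for K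
    proof -
      obtain c where "K *v x = c *\<^sub>R x"
        using eig[OF K] by blast
      then have "K *v z = c *\<^sub>R z"
        by (simp add: z_def matrix_vector_mult_scaleR)
      then show ?thesis by blast
    qed
    moreover have "y \<bullet> (B *v z) = 0" "z \<bullet> (B *v y) = 0" if "y \<in> E" for y
      using zW that by (auto simp: sym[of z])
    ultimately have "good (insert z E)"
      using E zz unfolding good_def by auto
    moreover have "card (insert z E) = Suc k"
      using \<open>finite E\<close> \<open>z \<notin> E\<close> E by simp
    ultimately show ?case by blast
  qed
  \<comment> \<open>A system of full size can be indexed by \<open>'n\<close>, so that it can serve
    as the columns of a square matrix.\<close>
  from this[of "CARD('n)"] obtain E where E: "good E" "card E = CARD('n)"
    by auto
  then obtain e :: "'n \<Rightarrow> real^'n" where e: "bij_betw e UNIV E"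
    by (metis finite_same_card_bij finite good_def)
  have "e i \<in> E" "e i = e j \<longleftrightarrow> i = j" for i j
    using e by (auto simp: bij_betw_def inj_on_def)
  then show ?thesis
    using E(1) unfolding good_def by (intro exI[of _ e]) auto
qed

section \<open>Diagonal matrices and simultaneous congruence\<close>

definition diag_mat :: "('n \<Rightarrow> real) \<Rightarrow> real^'n^'n" where
  "diag_mat d = (\<chi> i j. if i = j then d i else 0)"

lemma diag_mat_mult_left: "(diag_mat d ** M) $ i $ j = d i * M $ i $ j"
  by (simp add: diag_mat_def matrix_matrix_mult_def if_distrib[of "\<lambda>x. x * _"] cong: if_cong)

lemma diag_mat_mult_right: "(M ** diag_mat d) $ i $ j = M $ i $ j * d j"
  by (simp add: diag_mat_def matrix_matrix_mult_def if_distrib[of "\<lambda>x. _ * x"] cong: if_cong)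

lemma diag_mat_commute: "diag_mat c ** diag_mat d = diag_mat d ** diag_mat c"
  by (simp add: vec_eq_iff diag_mat_mult_left) (simp add: diag_mat_def)

lemma invertible_diag_mat:
  assumes "\<And>i. d i \<noteq> 0"
  shows "invertible (diag_mat d)"
  unfolding invertible_def
  by (intro exI[of _ "diag_mat (\<lambda>i. 1 / d i)"])
    (simp add: vec_eq_iff diag_mat_mult_left diag_mat_mult_right, simp add: diag_mat_def mat_def assms)

lemma congruence_diag_mat_nth:
  "(transpose Q ** diag_mat d ** Q) $ j $ k = (\<Sum>l\<in>UNIV. d l * Q $ l $ j * Q $ l $ k)"
proof -
  have "(transpose Q ** diag_mat d ** Q) $ j $ k
      = (\<Sum>l\<in>UNIV. (transpose Q ** diag_mat d) $ j $ l * Q $ l $ k)"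
    by (simp add: matrix_matrix_mult_def)
  then show ?thesis
    by (simp add: diag_mat_mult_right transpose_def mult.commute)
qed

lemma matrix_inv:
  fixes A :: "real^'n::finite^'n"
  assumes "invertible A"
  shows matrix_inv_right: "A ** matrix_inv A = mat 1"
    and matrix_inv_left: "matrix_inv A ** A = mat 1"
    and invertible_matrix_inv: "invertible (matrix_inv A)"
proof -
  have "A ** matrix_inv A = mat 1 \<and> matrix_inv A ** A = mat 1"
    using assms unfolding matrix_inv_def invertible_def by (rule someI_ex)
  then show "A ** matrix_inv A = mat 1" "matrix_inv A ** A = mat 1" "invertible (matrix_inv A)"
    by (auto simp: invertible_def)
qed

lemma positive_definite_invertible:
  fixes B :: "real^'n::finite^'n"
  assumes "positive_definite B"
  shows "invertible B"
proof -
  have "x = 0" if "B *v x = 0" for x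
    using assms that by (force simp: positive_definite_def)
  then show ?thesis
    using invertible_left_inverse matrix_left_invertible_ker by blast
qed

text \<open>Symmetry of \<open>M\<close> says that \<open>matrix_inv B ** M\<close> is self-adjoint
  for the inner product of \<open>B\<close>. In a \<open>B\<close>-orthonormal basis of common
  eigenvectors the forms of all \<open>M\<close> in \<open>V\<close> are diagonal; \<open>Q\<close>
  is the inverse of the matrix of basis vectors.\<close>

lemma simultaneous_congruence:
  fixes B :: "real^'n::finite^'n"
  assumes B: "positive_definite B"
    and sym: "\<And>M. M \<in> V \<Longrightarrow> transpose M = M"
    and comm: "commuting ((\<lambda>M. matrix_inv B ** M) ` V)"
  shows "\<exists>Q :: real^'n^'n. invertible Q \<and> (\<forall>M\<in>V. \<exists>d. M = transpose Q ** diag_mat d ** Q)"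
proof -
  let ?K = "\<lambda>M. matrix_inv B ** M"
  have invB: "invertible B"
    by (rule positive_definite_invertible[OF B])
  have BK: "B ** ?K M = M" for M :: "real^'n^'n"
    using matrix_inv_right[OF invB] by (simp add: matrix_mul_assoc)
  have adj: "x \<bullet> (B *v (K *v y)) = (K *v x) \<bullet> (B *v y)" if "K \<in> ?K ` V" for K x y
  proof -
    obtain M where M: "M \<in> V" "K = ?K M"
      using \<open>K \<in> ?K ` V\<close> by blast
    have swap: "u \<bullet> (N *v v) = (N *v u) \<bullet> v" if "transpose N = N" for N :: "real^'n^'n" and u v
      using that by (metis dot_lmul_matrix transpose_matrix_vector)
    have "x \<bullet> (B *v (K *v y)) = x \<bullet> (M *v y)"
      by (simp add: M BK matrix_vector_mul_assoc)
    also have "\<dots> = (M *v x) \<bullet> y"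
      by (rule swap[OF sym[OF M(1)]])
    also have "\<dots> = (B *v (K *v x)) \<bullet> y"
      by (simp add: M BK matrix_vector_mul_assoc)
    also have "\<dots> = (K *v x) \<bullet> (B *v y)"
      using B by (intro swap[symmetric]) (simp add: positive_definite_def)
    finally show ?thesis .
  qed
  obtain e :: "'n \<Rightarrow> real^'n" where orth: "\<And>i j. e i \<bullet> (B *v e j) = (if i = j then 1 else 0)"
    and eig: "\<And>K i. K \<in> ?K ` V \<Longrightarrow> \<exists>c. K *v e i = c *\<^sub>R e i"
    using orthonormal_common_eigenvectors[OF B adj comm] by blast
  define P :: "real^'n^'n" where "P = (\<chi> i l. e l $ i)"
  have entry: "(transpose P ** (N ** P)) $ a $ c = e a \<bullet> (N *v e c)" for N a c
    by (simp add: P_def matrix_matrix_mult_def transpose_def inner_vec_def matrix_vector_mult_def)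
  \<comment> \<open>\<open>B\<close>-orthonormality of the columns of \<open>P\<close>; it exhibits
    a left inverse of \<open>P\<close>.\<close>
  have "(transpose P ** B) ** P = mat 1"
    by (simp add: vec_eq_iff entry orth mat_def flip: matrix_mul_assoc)
  then have invP: "invertible P"
    using invertible_left_inverse by blast
  define Q where "Q = matrix_inv P"
  have PQ: "P ** Q = mat 1"
    unfolding Q_def by (rule matrix_inv_right[OF invP])
  have "invertible Q"
    using invP by (simp add: Q_def invertible_matrix_inv)
  moreover have "\<exists>d. M = transpose Q ** diag_mat d ** Q" if M: "M \<in> V" for M
  proof -
    obtain d where d: "\<And>i. ?K M *v e i = d i *\<^sub>R e i"
      using eig[of "?K M"] M by (metis imageI)
    \<comment> \<open>Applying \<open>B\<close> to the eigenvector equation turns it into a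
      statement about \<open>M\<close>, whose pairing with \<open>e a\<close> is then given by
      \<open>orth\<close>.\<close>
    have Me: "M *v e i = d i *\<^sub>R (B *v e i)" for i
      by (metis BK d matrix_vector_mul_assoc matrix_vector_mult_scaleR)
    have "(transpose P ** (M ** P)) $ a $ c = diag_mat d $ a $ c" for a c
      by (simp add: entry Me orth diag_mat_def)
    then have diag: "transpose P ** (M ** P) = diag_mat d"
      by (simp add: vec_eq_iff)
    have "transpose Q ** diag_mat d ** Q = transpose (P ** Q) ** M ** (P ** Q)"
      by (simp add: matrix_transpose_mul matrix_mul_assoc flip: diag)
    then have "M = transpose Q ** diag_mat d ** Q"
      by (simp add: PQ)
    then show ?thesis by blast
  qed
  ultimately show ?thesis by blast
qed

section \<open>Slice spaces and sums of cubes\<close>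

text \<open>Since \<open>B\<close> lies in \<open>V\<close>, \<open>C = matrix_inv A ** B\<close>
  belongs to the commuting family. Its inverse \<open>D\<close> then commutes with the family too,
  and \<open>matrix_inv B ** M\<close> is \<open>D\<close> times a member of the family.\<close>

lemma commuting_change_base:
  fixes A B :: "real^'n::finite^'n"
  assumes A: "invertible A" and B: "B \<in> V" "invertible B"
    and comm: "commuting ((\<lambda>M. matrix_inv A ** M) ` V)"
  shows "commuting ((\<lambda>M. matrix_inv B ** M) ` V)"
proof -
  define C D where "C = matrix_inv A ** B" and "D = matrix_inv B ** A"
  have CD: "D ** C = mat 1" "C ** D = mat 1"
    using matrix_inv[OF A] matrix_inv[OF B(2)] unfolding C_def D_def
    by (metis matrix_mul_assoc matrix_mul_lid)+
  have base: "matrix_inv B ** M = D ** (matrix_inv A ** M)" for M :: "real^'n^'n"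
    using matrix_inv_right[OF A] unfolding D_def by (metis matrix_mul_assoc matrix_mul_lid)
  have cM: "C ** (matrix_inv A ** M) = (matrix_inv A ** M) ** C" if "M \<in> V" for M
    using comm B that by (auto simp: commuting_def C_def)
  have dM: "D ** (matrix_inv A ** M) = (matrix_inv A ** M) ** D" if "M \<in> V" for M
  proof -
    have "D ** (matrix_inv A ** M) = D ** ((matrix_inv A ** M) ** C) ** D"
      using CD by (metis matrix_mul_assoc matrix_mul_rid)
    also have "\<dots> = D ** (C ** (matrix_inv A ** M)) ** D"
      by (simp add: cM[OF that])
    also have "\<dots> = (matrix_inv A ** M) ** D"
      using CD by (simp add: matrix_mul_assoc)
    finally show ?thesis .
  qed
  have "(D ** X) ** (D ** Y) = (D ** Y) ** (D ** X)"
    if "X ** Y = Y ** X" "D ** X = X ** D" "D ** Y = Y ** D" for X Y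
    using that by (metis matrix_mul_assoc)
  then show ?thesis
    using comm dM by (auto simp: commuting_def base)
qed

text \<open>Through \<open>span_minimal\<close> this carries the diagonal form of the slices over to
  their span.\<close>

lemma subspace_congruence_diag_mat: "subspace {transpose Q ** diag_mat d ** Q | d. True}"
proof -
  have "0 = transpose Q ** diag_mat (\<lambda>_. 0) ** Q"
    by (simp add: vec_eq_iff congruence_diag_mat_nth)
  moreover have "transpose Q ** diag_mat c ** Q + transpose Q ** diag_mat d ** Q
      = transpose Q ** diag_mat (\<lambda>l. c l + d l) ** Q" for c d
    by (simp add: vec_eq_iff congruence_diag_mat_nth sum.distrib algebra_simps)
  moreover have "r *\<^sub>R (transpose Q ** diag_mat d ** Q)
      = transpose Q ** diag_mat (\<lambda>l. r * d l) ** Q" for r d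
    by (simp add: vec_eq_iff congruence_diag_mat_nth sum_distrib_left algebra_simps)
  ultimately show ?thesis
    unfolding subspace_def by blast
qed

text \<open>It suffices that \<open>M ** matrix_inv A ** N\<close> is symmetric in \<open>M\<close>
  and \<open>N\<close>. In the coordinates of \<open>Q\<close> this is a product of diagonal
  matrices with \<open>E\<close>, the inverse of a diagonal matrix, and all of these
  commute.\<close>

lemma commuting_congruence_diag_mat:
  fixes A Q :: "real^'n::finite^'n"
  assumes Q: "invertible Q" and A: "invertible A"
    and V: "\<And>M. M \<in> V \<Longrightarrow> \<exists>d. M = transpose Q ** diag_mat d ** Q" and AV: "A \<in> V"
  shows "commuting ((\<lambda>M. matrix_inv A ** M) ` V)"
proof -
  define E where "E = Q ** matrix_inv A ** transpose Q"
  obtain a where a: "A = transpose Q ** diag_mat a ** Q"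
    using V[OF AV] by blast
  have "E ** diag_mat a = Q ** matrix_inv A ** (transpose Q ** diag_mat a ** Q) ** matrix_inv Q"
    unfolding E_def using matrix_inv_right[OF Q] by (metis matrix_mul_assoc matrix_mul_rid)
  also have "\<dots> = mat 1"
    using matrix_inv_right[OF Q] matrix_inv_left[OF A]
    by (metis a matrix_mul_assoc matrix_mul_rid)
  finally have Ea: "E ** diag_mat a = mat 1" .
  then have aE: "diag_mat a ** E = mat 1"
    by (simp add: matrix_left_right_inverse)
  have E_comm: "E ** diag_mat d = diag_mat d ** E" for d
    using Ea aE diag_mat_commute[of a d] by (metis matrix_mul_assoc matrix_mul_lid matrix_mul_rid)
  have "M ** matrix_inv A ** N = N ** matrix_inv A ** M" if M: "M \<in> V" and N: "N \<in> V" for M N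
  proof -
    obtain c d where cd: "M = transpose Q ** diag_mat c ** Q" "N = transpose Q ** diag_mat d ** Q"
      using V M N by blast
    have "diag_mat c ** E ** diag_mat d = diag_mat d ** E ** diag_mat c"
      using E_comm diag_mat_commute by (metis matrix_mul_assoc)
    then have "transpose Q ** (diag_mat c ** E ** diag_mat d) ** Q
        = transpose Q ** (diag_mat d ** E ** diag_mat c) ** Q"
      by simp
    then show ?thesis
      by (simp add: cd E_def matrix_mul_assoc)
  qed
  then show ?thesis
    unfolding commuting_def by (auto simp: matrix_mul_assoc) (metis matrix_mul_assoc)
qed

section \<open>Symmetry of the slice space, and the slice space of a sum of cubes\<close>

lemma transpose_slice_space:
  fixes f :: "'n::finite rpoly"
  assumes "M \<in> slice_space f"
  shows "transpose M = M"
proof -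
  have "subspace {M :: real^'n^'n. transpose M = M}"
    by (auto simp: subspace_def transpose_def vec_eq_iff)
  moreover have "range (slice f) \<subseteq> {M. transpose M = M}"
    by (auto simp: transpose_slice)
  ultimately show ?thesis
    using assms span_minimal unfolding slice_space_def by blast
qed

lemma slice_linear_subst:
  "slice (linear_subst sum_of_cubes A) i = transpose A ** diag_mat (\<lambda>l. A $ l $ i) ** A"
  by (simp add: vec_eq_iff slice_linear_subst_sum_of_cubes congruence_diag_mat_nth)

lemma slice_space_linear_subst:
  assumes "M \<in> slice_space (linear_subst sum_of_cubes A)"
  shows "\<exists>d. M = transpose A ** diag_mat d ** A"
proof -
  have "slice_space (linear_subst sum_of_cubes A) \<subseteq> {transpose A ** diag_mat d ** A | d. True}"
    unfolding slice_space_def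
    by (rule span_minimal[OF _ subspace_congruence_diag_mat]) (auto simp: slice_linear_subst)
  with assms show ?thesis by blast
qed

lemma positive_definite_in_slice_space:
  fixes A :: "real^'n::finite^'n"
  assumes A: "invertible A"
  shows "\<exists>B\<in>slice_space (linear_subst sum_of_cubes A). positive_definite B"
proof -
  let ?f = "linear_subst sum_of_cubes A"
  \<comment> \<open>Here \<open>1\<close> is the all-ones vector. The diagonal factors of the slices
    have entries \<open>A $ l $ i\<close>, so weights \<open>c\<close> with
    \<open>A *v c = 1\<close> combine them to the identity matrix, and the slices to
    \<open>transpose A ** A\<close>.\<close>
  define c where "c = matrix_inv A *v 1"
  have "A *v c = 1"
    using matrix_inv_right[OF A] by (simp add: c_def matrix_vector_mul_assoc)
  then have c: "(\<Sum>i\<in>UNIV. A $ l $ i * c $ i) = 1" for l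
    by (simp add: vec_eq_iff matrix_vector_mult_def)
  have "(\<Sum>i\<in>UNIV. c $ i *\<^sub>R slice ?f i) \<in> slice_space ?f"
    unfolding slice_space_def by (intro span_sum span_scale span_base) auto
  moreover have "(\<Sum>i\<in>UNIV. c $ i *\<^sub>R slice ?f i) = transpose A ** A"
  proof -
    have "(\<Sum>i\<in>UNIV. c $ i *\<^sub>R slice ?f i) $ j $ k = (transpose A ** A) $ j $ k" for j k
    proof -
      have "(\<Sum>i\<in>UNIV. c $ i *\<^sub>R slice ?f i) $ j $ k
          = (\<Sum>i\<in>UNIV. \<Sum>l\<in>UNIV. A $ l $ i * c $ i * (A $ l $ j * A $ l $ k))"
        by (simp add: slice_linear_subst_sum_of_cubes sum_distrib_left ac_simps)
      also have "\<dots> = (\<Sum>l\<in>UNIV. (\<Sum>i\<in>UNIV. A $ l $ i * c $ i) * (A $ l $ j * A $ l $ k))"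
        by (subst sum.swap) (simp add: sum_distrib_right)
      finally show ?thesis
        by (simp add: c matrix_matrix_mult_def transpose_def)
    qed
    then show ?thesis
      by (simp add: vec_eq_iff)
  qed
  moreover have "positive_definite (transpose A ** A)"
  proof -
    have "x \<bullet> ((transpose A ** A) *v x) = (A *v x) \<bullet> (A *v x)" for x
      by (metis dot_lmul_matrix inner_commute matrix_vector_mul_assoc transpose_matrix_vector)
    moreover have "A *v x \<noteq> 0" if "x \<noteq> 0" for x
      using that matrix_inv_left[OF A] by (metis matrix_left_invertible_ker)
    ultimately show ?thesis
      by (simp add: positive_definite_def matrix_transpose_mul)
  qed
  ultimately show ?thesis by auto
qed

text \<open>Condition (ii) with the positive definite matrix itself as base implies (i).
  Diagonalization alone leaves the diagonals of the slices unrelated; the symmetry of the cubic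
  tensor ties them to the rows of \<open>Q\<close>.\<close>

lemma equivalent_to_sum_of_cubesI:
  fixes f :: "'n::finite rpoly"
  assumes f: "homogeneous 3 f"
    and B: "B \<in> slice_space f" "positive_definite B"
    and comm: "commuting ((\<lambda>M. matrix_inv B ** M) ` slice_space f)"
  shows "equivalent_to_sum_of_cubes f"
proof -
  obtain Q :: "real^'n^'n" where Q: "invertible Q"
    and diag: "\<And>M. M \<in> slice_space f \<Longrightarrow> \<exists>d. M = transpose Q ** diag_mat d ** Q"
    using simultaneous_congruence[OF B(2) _ comm] transpose_slice_space by blast
  have "\<forall>i. \<exists>d. slice f i = transpose Q ** diag_mat d ** Q"
    by (intro allI diag) (simp add: slice_space_def span_base)
  from choice[OF this] obtain d where d: "\<And>i. slice f i = transpose Q ** diag_mat (d i) ** Q"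
    by blast
  define P where "P = matrix_inv Q"
  have QP: "Q ** P = mat 1"
    unfolding P_def by (rule matrix_inv_right[OF Q])
  \<comment> \<open>Multiplying by \<open>P\<close> cancels the right factor \<open>Q\<close> and
    isolates a single index \<open>l\<close>; the symmetry of the slices in \<open>i\<close> and
    \<open>j\<close> survives, since \<open>P\<close> acts on the third index only.\<close>
  have slice_P: "(slice f i ** P) $ j $ l = d i l * Q $ l $ j" for i j l
  proof -
    have "slice f i ** P = transpose Q ** diag_mat (d i)"
      unfolding d using QP by (metis matrix_mul_assoc matrix_mul_rid)
    then show ?thesis
      by (simp add: diag_mat_mult_right transpose_def)
  qed
  have d_swap: "d i l * Q $ l $ j = d j l * Q $ l $ i" for i j l
    using slice_P[of i j l] slice_P[of j i l]
    by (simp add: matrix_matrix_mult_def slice_commute[of f i j])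
  have "\<exists>s. s \<noteq> 0 \<and> (\<forall>i. d i l = s * Q $ l $ i)" for l
  proof -
    have "\<exists>j. Q $ l $ j \<noteq> 0"
    proof (rule ccontr)
      assume "\<not> ?thesis"
      then have "(Q ** P) $ l $ l = 0"
        by (simp add: matrix_matrix_mult_def)
      then show False
        by (simp add: QP mat_def)
    qed
    then obtain j where j: "Q $ l $ j \<noteq> 0"
      by blast
    define r where "r = d j l / Q $ l $ j"
    \<comment> \<open>The vectors \<open>(d i l)\<^sub>i\<close> and \<open>(Q $ l $ i)\<^sub>i\<close> are proportional, as \<open>d i l * Q $ l $ j\<close> is symmetric in \<open>i, j\<close>.\<close>
    have s: "d i l = r * Q $ l $ i" for i
      using d_swap[of i l j] j by (simp add: r_def field_simps)
    moreover have "r \<noteq> 0"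
    proof
      assume "r = 0"
      then have d0: "d i l = 0" for i
        by (simp add: s)
      \<comment> \<open>Vanishing of column \<open>l\<close> of \<open>M ** P\<close> is a linear
        condition on \<open>M\<close>, so it passes from the slices to \<open>B\<close>. This is
        impossible because \<open>B ** P\<close> has a left inverse.\<close>
      have "subspace {M. \<forall>j. (M ** P) $ j $ l = 0}"
        by (auto simp: subspace_def matrix_matrix_mult_def distrib_right sum.distrib mult.assoc
            simp flip: sum_distrib_left)
      moreover have "range (slice f) \<subseteq> {M. \<forall>j. (M ** P) $ j $ l = 0}"
        by (auto simp: slice_P d0)
      ultimately have "(B ** P) $ j $ l = 0" for j
        using B(1) span_minimal unfolding slice_space_def by blast
      moreover have "Q ** matrix_inv B ** (B ** P) = mat 1"
        using QP matrix_inv_left[OF positive_definite_invertible[OF B(2)]]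
        by (metis matrix_mul_assoc matrix_mul_rid)
      then have "(Q ** matrix_inv B ** (B ** P)) $ l $ l = 1"
        by (simp add: mat_def)
      ultimately show False
        by (simp add: matrix_matrix_mult_def[of "Q ** matrix_inv B"])
    qed
    ultimately show ?thesis by blast
  qed
  then obtain s where s: "\<And>l. s l \<noteq> 0" "\<And>i l. d i l = s l * Q $ l $ i"
    by metis
  \<comment> \<open>A factor \<open>s l\<close> in front of a cube is absorbed by scaling row
    \<open>l\<close> of \<open>Q\<close> with its real cube root, which exists for either sign and
    is nonzero.\<close>
  define A where "A = diag_mat (\<lambda>l. root 3 (s l)) ** Q"
  have "invertible A"
    unfolding A_def using s(1) by (intro invertible_mult invertible_diag_mat Q) simp
  moreover have "f = linear_subst sum_of_cubes A"
  proof (rule homogeneous_eqI[OF f homogeneous_linear_subst_sum_of_cubes])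
    have A_nth: "A $ l $ i = root 3 (s l) * Q $ l $ i" for l i
      by (simp add: A_def diag_mat_mult_left)
    have cube: "root 3 (s l) * root 3 (s l) * root 3 (s l) = s l" for l
      using odd_real_root_pow[of 3 "s l"] by (simp add: power3_eq_cube)
    have "A $ l $ i * A $ l $ j * A $ l $ k = d i l * Q $ l $ j * Q $ l $ k" for i j k l
    proof -
      have "A $ l $ i * A $ l $ j * A $ l $ k
          = (root 3 (s l) * root 3 (s l) * root 3 (s l)) * (Q $ l $ i * Q $ l $ j * Q $ l $ k)"
        unfolding A_nth by (simp add: ac_simps)
      then show ?thesis
        unfolding cube s(2) by (simp add: ac_simps)
    qed
    then show "slice f i = slice (linear_subst sum_of_cubes A) i" for i
      by (simp add: vec_eq_iff slice_linear_subst_sum_of_cubes d congruence_diag_mat_nth)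
  qed
  ultimately show ?thesis
    unfolding equivalent_to_sum_of_cubes_def by blast
qed

theorem theorem3p8:
  fixes f :: "'n::finite rpoly"
  assumes "homogeneous 3 f"
  defines "V \<equiv> slice_space f"
  shows "(equivalent_to_sum_of_cubes f \<longleftrightarrow>
           (\<exists>A\<in>V. \<exists>B\<in>V. invertible A \<and> invertible B \<and>
              commuting ((\<lambda>M. matrix_inv A ** M) ` V) \<and> positive_definite B))
       \<and> (equivalent_to_sum_of_cubes f \<longleftrightarrow>
           (\<exists>B\<in>V. positive_definite B) \<and>
           (\<forall>A\<in>V. invertible A \<longrightarrow> commuting ((\<lambda>M. matrix_inv A ** M) ` V)))"
    (is "(_ \<longleftrightarrow> ?ii) \<and> (_ \<longleftrightarrow> ?iii)")
proof -
  have "?iii" if equiv: "equivalent_to_sum_of_cubes f"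
  proof -
    obtain A where A: "invertible A" "f = linear_subst sum_of_cubes A"
      using equiv unfolding equivalent_to_sum_of_cubes_def by blast
    show ?thesis
      unfolding V_def A(2)
      using positive_definite_in_slice_space[OF A(1)]
        commuting_congruence_diag_mat[OF A(1) _ slice_space_linear_subst] by blast
  qed
  \<comment> \<open>The positive definite matrix is invertible and serves as both \<open>A\<close>
    and \<open>B\<close>.\<close>
  moreover have "?ii" if "?iii"
    using that positive_definite_invertible by blast
  \<comment> \<open>The commuting condition is first moved from the base \<open>A\<close> to the
    positive definite base \<open>B\<close>.\<close>
  moreover have "equivalent_to_sum_of_cubes f" if "?ii"
    using that commuting_change_base equivalent_to_sum_of_cubesI[OF assms(1)]
    unfolding V_def by blast
  ultimately show ?thesis by blast
qed

end
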